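(* The Riemann zeta function $\zeta(s)=\sum_{n\in\mathbb{N}}n^{-s}$ does not vanish in the half-plane $\{s\in\mathbb{C}:\operatorname{Re}(s)>1\}$.
   Context: $\mathbb{N}$ denotes the set of positive integers. *)

theory Defs
  imports "HOL-Analysis.Analysis"
begin

text \<open>
  The series converges absolutely for \<open>Re s > 1\<close>, and only there; elsewhere \<^const>\<open>infsum\<close> returns
  the dummy value \<open>0\<close>, so this constant is the zeta function only on that half-plane and is
  not its analytic continuation.
\<close>

definition riemann_zeta :: "complex \<Rightarrow> complex" where
  "riemann_zeta s = (\<Sum>\<^sub>\<infinity>n\<in>{1::nat..}. of_nat n powr (- s))"

end

theory Submission
  imports Defs "HOL-Computational_Algebra.Primes"
begin

text \<open>
  The argument is a finite form of the Euler product. For a completely multiplicative, absolutely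
  summable \<open>f\<close>, let \<open>F\<^sub>k\<close> be the sum of \<open>f\<close> over the positive integers without prime factors \<open>\<le> k\<close>.
  Sorting these integers by divisibility by a prime \<open>p = k + 1\<close> gives
  \<open>F\<^sub>k = F\<^sub>k\<^sub>+\<^sub>1 + f p \<cdot> F\<^sub>k\<close>, that is, each prime strips off one Euler factor
  (lemma \<open>infsum_rough_Suc\<close>). Hence if the full sum \<open>F\<^sub>0\<close> vanishes, then so does every \<open>F\<^sub>k\<close>.
  But the positive integers without small prime factors are \<open>1\<close> and some large integers, so \<open>F\<^sub>k\<close>
  differs from \<open>f 1 = 1\<close> by at most a tail of an absolutely convergent series, and it cannot vanish
  for large \<open>k\<close>. The zeta function is the case \<open>f n = n\<^sup>-\<^sup>s\<close>.
\<close>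

text \<open>
  The rough numbers of sieve theory. Prime factors \<open>\<le> k\<close> rather than \<open>< k\<close> are excluded, so that
  the step from \<open>k\<close> to \<open>Suc k\<close> concerns divisibility by \<open>Suc k\<close>.
\<close>

definition rough :: "nat \<Rightarrow> nat set" where
  "rough k = {n. n \<ge> 1 \<and> (\<forall>p. prime p \<longrightarrow> p dvd n \<longrightarrow> p > k)}"

lemma rough_subset: "rough k \<subseteq> {1..}"
  by (auto simp: rough_def)

lemma rough_0: "rough 0 = {1..}"
  by (auto simp: rough_def prime_gt_0_nat)

lemma one_in_rough: "1 \<in> rough k"
  by (auto simp: rough_def)

lemma rough_gt:
  assumes "n \<in> rough k" "n \<noteq> 1"
  shows "n > k"
proof -
  obtain p where p: "prime p" "p dvd n"
    using assms(2) prime_factor_nat by blast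
  then have "k < p" "p \<le> n"
    using assms(1) by (auto simp: rough_def intro: dvd_imp_le)
  then show ?thesis by simp
qed

lemma rough_Suc_not_prime:
  assumes "\<not> prime (Suc k)"
  shows "rough (Suc k) = rough k"
  using assms by (auto simp: rough_def) (metis Suc_lessI)

lemma rough_split:
  assumes "prime (Suc k)"
  shows "rough k = rough (Suc k) \<union> (*) (Suc k) ` rough k"
    and "rough (Suc k) \<inter> (*) (Suc k) ` rough k = {}"
proof -
  let ?p = "Suc k"
  have "n \<in> rough ?p \<union> (*) ?p ` rough k" if n: "n \<in> rough k" for n
  proof (cases "?p dvd n")
    case True
    then obtain m where m: "n = ?p * m" by (elim dvdE)
    with n have "m \<in> rough k" by (auto simp: rough_def Suc_le_eq simp del: mult_Suc)
    with m show ?thesis by blast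
  next
    case False
    with n show ?thesis by (auto simp: rough_def) (metis Suc_lessI)
  qed
  moreover have "?p * m \<in> rough k" if m: "m \<in> rough k" for m
  proof -
    have "q > k" if q: "prime q" "q dvd ?p * m" for q
    proof -
      have "q = ?p \<or> q dvd m"
        using q assms by (metis prime_dvd_mult_iff primes_dvd_imp_eq)
      then show ?thesis using m q(1) by (auto simp: rough_def)
    qed
    then show ?thesis using m by (auto simp: rough_def)
  qed
  moreover have "rough ?p \<subseteq> rough k"
    by (auto simp: rough_def)
  ultimately show "rough k = rough ?p \<union> (*) ?p ` rough k"
    by blast
  have "\<not> ?p dvd n" if "n \<in> rough ?p" for n
    using that assms by (auto simp: rough_def)
  then show "rough ?p \<inter> (*) ?p ` rough k = {}"
    using dvd_triv_left by blast
qed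

text \<open>
  Splitting off the multiples of the prime \<open>Suc k\<close> and pulling the factor \<open>f (Suc k)\<close> out of
  their sum removes the Euler factor at \<open>Suc k\<close>.
\<close>

lemma infsum_rough_Suc:
  fixes f :: "nat \<Rightarrow> 'a :: {real_normed_field, banach}"
  assumes mult: "\<And>m n. m \<ge> 1 \<Longrightarrow> n \<ge> 1 \<Longrightarrow> f (m * n) = f m * f n"
    and abs: "(\<lambda>n. norm (f n)) summable_on {1..}"
    and prime: "prime (Suc k)"
  shows "infsum f (rough (Suc k)) = (1 - f (Suc k)) * infsum f (rough k)"
proof -
  let ?p = "Suc k"
  have sub: "(*) ?p ` rough k \<subseteq> {1..}"
    using rough_split(1)[OF prime] rough_subset[of k] by blast
  have summ: "f summable_on A" if "A \<subseteq> {1..}" for A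
    by (rule summable_on_subset_banach[OF abs_summable_summable[OF abs] that])
  have "infsum f ((*) ?p ` rough k) = infsum (f \<circ> (*) ?p) (rough k)"
    by (rule infsum_reindex) (auto simp: inj_on_def simp del: mult_Suc)
  also have "\<dots> = (\<Sum>\<^sub>\<infinity>n\<in>rough k. f ?p * f n)"
    by (rule infsum_cong) (use mult in \<open>auto simp: rough_def simp del: mult_Suc\<close>)
  also have "\<dots> = f ?p * infsum f (rough k)"
    by (rule infsum_cmult_right) (rule summ[OF rough_subset])
  finally have "infsum f ((*) ?p ` rough k) = f ?p * infsum f (rough k)" .
  moreover have "infsum f (rough k) = infsum f (rough ?p) + infsum f ((*) ?p ` rough k)"
    using infsum_Un_disjoint[OF summ[OF rough_subset] summ[OF sub] rough_split(2)[OF prime]]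
    unfolding rough_split(1)[OF prime, symmetric] .
  ultimately show ?thesis by (simp add: algebra_simps)
qed

text \<open>
  If the sum vanished, so would its restriction to every \<open>rough k\<close>. Take a finite set \<open>F\<close> that
  carries the sum of norms up to an error of \<open>1/2\<close>, and \<open>k\<close> at least its largest element. Then the
  elements of \<open>rough k\<close> other than \<open>1\<close> lie outside \<open>F\<close>, and together they cannot cancel \<open>f 1 = 1\<close>.
\<close>

theorem infsum_completely_multiplicative_nonzero:
  fixes f :: "nat \<Rightarrow> 'a :: {real_normed_field, banach}"
  assumes one: "f 1 = 1"
    and mult: "\<And>m n. m \<ge> 1 \<Longrightarrow> n \<ge> 1 \<Longrightarrow> f (m * n) = f m * f n"
    and abs: "(\<lambda>n. norm (f n)) summable_on {1..}"
  shows "infsum f {1..} \<noteq> 0"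
proof
  assume zero: "infsum f {1..} = 0"
  have rough_zero: "infsum f (rough k) = 0" for k
  proof (induction k)
    case 0
    show ?case using zero by (simp add: rough_0)
  next
    case (Suc k)
    then show ?case
      by (cases "prime (Suc k)") (simp_all add: infsum_rough_Suc[OF mult abs] rough_Suc_not_prime)
  qed
  let ?g = "\<lambda>n. norm (f n)"
  obtain F where F: "finite F" "F \<subseteq> {1..}"
      "dist (sum ?g F) (infsum ?g {1..}) \<le> 1/2"
    using infsum_finite_approximation[OF abs, of "1/2"] by auto
  have "infsum ?g ({1..} - F) = infsum ?g {1..} - sum ?g F"
    using infsum_Diff[OF abs _ F(2)] F(1) by simp
  then have tail: "infsum ?g ({1..} - F) \<le> 1/2"
    using F(3) unfolding dist_real_def by linarith
  define k where "k = Max (insert 0 F)"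
  have sub: "rough k - {1} \<subseteq> {1..} - F"
  proof
    fix n assume n: "n \<in> rough k - {1}"
    then have "n > k" using rough_gt by blast
    then have "n \<notin> F" using F(1) by (auto simp: k_def)
    then show "n \<in> {1..} - F" using n rough_subset by auto
  qed
  have abs_sub: "(\<lambda>n. norm (f n)) summable_on A" if "A \<subseteq> {1..}" for A
    using abs that by (rule summable_on_subset_banach)
  have "infsum f (rough k - {1}) = infsum f (rough k) - infsum f {1}"
    by (rule infsum_Diff)
      (use one_in_rough abs_summable_summable[OF abs_sub[OF rough_subset]] in auto)
  then have "infsum f (rough k - {1}) = - 1"
    using rough_zero one by simp
  then have "1 = norm (infsum f (rough k - {1}))" by simp
  also have "\<dots> \<le> infsum ?g (rough k - {1})"
    using abs_sub sub by (intro norm_infsum_bound) blast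
  also have "\<dots> \<le> infsum ?g ({1..} - F)"
    using sub by (intro infsum_mono2 abs_sub) auto
  finally show False using tail by simp
qed

lemma norm_of_nat_powr_summable_on:
  assumes "Re s > 1"
  shows "(\<lambda>n. norm (of_nat n powr (- s) :: complex)) summable_on A"
proof -
  have "norm (of_nat n powr (- s) :: complex) = real n powr (- Re s)" for n
    by (cases "n = 0") (simp_all add: norm_powr_real_powr)
  then have "summable (\<lambda>n. norm (of_nat n powr (- s) :: complex))"
    using assms by (simp add: summable_real_powr_iff)
  then have "(\<lambda>n. norm (of_nat n powr (- s) :: complex)) summable_on UNIV"
    by (simp add: summable_on_UNIV_nonneg_real_iff)
  then show ?thesis by (rule summable_on_subset_banach) simp
qed

theorem corollary2p3:
  shows "\<forall>s\<in>{s :: complex. Re s > 1}. riemann_zeta s \<noteq> 0"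
proof
  fix s :: complex assume "s \<in> {s. Re s > 1}"
  then have s: "Re s > 1" by simp
  have "of_nat (m * n) powr (- s) = of_nat m powr (- s) * (of_nat n powr (- s) :: complex)"
    for m n :: nat
    using powr_times_real[of "of_nat m" "of_nat n" "- s"] by simp
  then show "riemann_zeta s \<noteq> 0"
    unfolding riemann_zeta_def
    by (intro infsum_completely_multiplicative_nonzero norm_of_nat_powr_summable_on s) simp_all
qed

end
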